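(* Let $d\ge 2$ and $N\ge 1$ be integers. The set of functions $$\left\{ b_{k,\ell;j}(r,\theta)=r^{k+2j}Y_{k,\ell}(\theta)\;:\; k\ge 0,\ \ell=1,2,\dots,a_k,\ j=0,1,\dots,N-1\right\},$$ where $x=r\theta$ with $r=|x|$ and $\theta\in\mathbb{S}^{d-1}$, is a basis of the vector space of (complex-valued) polynomials in $x\in\mathbb{R}^d$ which are polyharmonic of order $N$.
   Context: $\mathbb{S}^{d-1}$ is the unit sphere of $\mathbb{R}^d$ with rotation-invariant measure $d\theta$. $\mathcal{H}_k(\mathbb{R}^d)$ is the space of harmonic homogeneous complex-valued polynomials of degree $k$ on $\mathbb{R}^d$, and $a_k=\dim\mathcal{H}_k(\mathbb{R}^d)$. For each $k$, $Y_{k,\ell}$, $\ell=1,\dots,a_k$, is a fixed basis of $\mathcal{H}_k(\mathbb{R}^d)$, orthonormal for $\langle f,g\rangle_{\mathbb{S}^{d-1}}=\int_{\mathbb{S}^{d-1}}f\overline{g}\,d\theta$; thus $Y_{k,\ell}(r\theta)=r^kY_{k,\ell}(\theta)$, and $r^{k+2j}Y_{k,\ell}(\theta)=|x|^{2j}Y_{k,\ell}(x)$. A function $f$ is polyharmonic of order $N$ if it is $2N$ times continuously differentiable and $\Delta^N f=0$, where $\Delta$ is the Laplace operator. *)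

theory Defs
  imports "HOL-Analysis.Analysis" "HOL-Library.Function_Algebras"
begin

text \<open>The complex vector space of all functions \<open>\<real>\<^sup>d \<rightarrow> \<complex>\<close>, with \<open>d = CARD('d)\<close>; addition is
  the pointwise one of \<open>Function_Algebras\<close>.\<close>

definition cscale :: "complex \<Rightarrow> (real ^ 'd \<Rightarrow> complex) \<Rightarrow> (real ^ 'd \<Rightarrow> complex)" where
  "cscale c f = (\<lambda>x. c * f x)"

global_interpretation cfun: vector_space "cscale :: complex \<Rightarrow> (real ^ 'd \<Rightarrow> complex) \<Rightarrow> _"
  by unfold_locales (auto simp: cscale_def fun_eq_iff algebra_simps)

definition is_basis_family ::
  "'i set \<Rightarrow> ('i \<Rightarrow> real ^ 'd \<Rightarrow> complex) \<Rightarrow> (real ^ 'd \<Rightarrow> complex) set \<Rightarrow> bool" where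
  "is_basis_family I v V \<longleftrightarrow>
     inj_on v I \<and> \<not> cfun.dependent (v ` I) \<and> cfun.span (v ` I) = V"

definition partial_deriv :: "'d \<Rightarrow> (real ^ 'd \<Rightarrow> complex) \<Rightarrow> real ^ 'd::finite \<Rightarrow> complex" where
  "partial_deriv i f x = frechet_derivative f (at x) (axis i 1)"

primrec times_cont_differentiable :: "nat \<Rightarrow> (real ^ 'd::finite \<Rightarrow> complex) \<Rightarrow> bool" where
  "times_cont_differentiable 0 f \<longleftrightarrow> continuous_on UNIV f"
| "times_cont_differentiable (Suc m) f \<longleftrightarrow>
     f differentiable_on UNIV \<and> (\<forall>i. times_cont_differentiable m (partial_deriv i f))"

definition laplacian :: "(real ^ 'd \<Rightarrow> complex) \<Rightarrow> real ^ 'd::finite \<Rightarrow> complex" where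
  "laplacian f x = (\<Sum>i\<in>UNIV. partial_deriv i (partial_deriv i f) x)"

definition polyharmonic :: "nat \<Rightarrow> (real ^ 'd::finite \<Rightarrow> complex) \<Rightarrow> bool" where
  "polyharmonic N f \<longleftrightarrow>
     times_cont_differentiable (2 * N) f \<and> (laplacian ^^ N) f = (\<lambda>_. 0)"

text \<open>Complex linear combinations of the monomials \<open>x\<^sup>\<alpha>\<close> with \<open>|\<alpha>| = k\<close>; the zero polynomial is
  homogeneous of every degree.\<close>

definition homogeneous_polynomial :: "nat \<Rightarrow> (real ^ 'd::finite \<Rightarrow> complex) \<Rightarrow> bool" where
  "homogeneous_polynomial k f \<longleftrightarrow>
     (\<exists>c :: ('d \<Rightarrow> nat) \<Rightarrow> complex.
        f = (\<lambda>x. \<Sum>\<alpha> | (\<Sum>i\<in>UNIV. \<alpha> i) = k. c \<alpha> * complex_of_real (\<Prod>i\<in>UNIV. x $ i ^ \<alpha> i)))"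

definition harmonic_polynomials :: "nat \<Rightarrow> (real ^ 'd::finite \<Rightarrow> complex) set" where
  "harmonic_polynomials k = {f. homogeneous_polynomial k f \<and> polyharmonic 1 f}"

definition harmonic_dim :: "'d::finite itself \<Rightarrow> nat \<Rightarrow> nat" where
  "harmonic_dim _ k = cfun.dim (harmonic_polynomials k :: (real ^ 'd \<Rightarrow> complex) set)"

definition polyharmonic_polynomials :: "nat \<Rightarrow> (real ^ 'd::finite \<Rightarrow> complex) set" where
  "polyharmonic_polynomials N = {f. polynomial_function f \<and> polyharmonic N f}"

text \<open>For \<open>d \<ge> 2\<close> such a measure is unique up to a positive factor, so this is the surface
  measure in an arbitrary normalization.\<close>

definition rotation_invariant_sphere_measure :: "(real ^ 'd::finite) measure \<Rightarrow> bool" where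
  "rotation_invariant_sphere_measure \<sigma> \<longleftrightarrow>
     sets \<sigma> = sets (restrict_space borel (sphere 0 1)) \<and>
     finite_measure \<sigma> \<and> emeasure \<sigma> (space \<sigma>) \<noteq> 0 \<and>
     (\<forall>Q. rotation_matrix Q \<longrightarrow> distr \<sigma> \<sigma> ((*v) Q) = \<sigma>)"

definition sphere_inner ::
  "(real ^ 'd::finite) measure \<Rightarrow> (real ^ 'd \<Rightarrow> complex) \<Rightarrow> (real ^ 'd \<Rightarrow> complex) \<Rightarrow> complex" where
  "sphere_inner \<sigma> f g = (LINT \<theta>|\<sigma>. f \<theta> * cnj (g \<theta>))"

text \<open>\<open>r\<^sup>k\<^sup>+\<^sup>2\<^sup>j Y\<^sub>k\<^sub>,\<^sub>l(\<theta>)\<close> for \<open>x = r \<theta>\<close>. At \<open>x = 0\<close>, where \<open>\<theta>\<close> is not determined, the formula below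
  evaluates \<open>Y k l\<close> at \<open>0\<close>; this is the intended value, because the factor \<open>0 ^ (k + 2 * j)\<close>
  vanishes unless \<open>k = j = 0\<close>, and elements of \<open>harmonic_polynomials 0\<close> are constant.\<close>

definition polar_fun ::
  "(nat \<Rightarrow> nat \<Rightarrow> real ^ 'd::finite \<Rightarrow> complex) \<Rightarrow> nat \<Rightarrow> nat \<Rightarrow> nat \<Rightarrow> real ^ 'd \<Rightarrow> complex" where
  "polar_fun Y k l j x = complex_of_real (norm x ^ (k + 2 * j)) * Y k l (x /\<^sub>R norm x)"

lemma polar_fun_polar_coordinates:
  assumes Y: "Y k l \<in> harmonic_polynomials k" and r: "0 \<le> r" and \<theta>: "\<theta> \<in> sphere 0 1"
  shows "polar_fun Y k l j (r *\<^sub>R \<theta>) = complex_of_real (r ^ (k + 2 * j)) * Y k l \<theta>"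
proof (cases "r = 0")
  case False
  then show ?thesis using r \<theta> by (simp add: polar_fun_def)
next
  case True
  show ?thesis
  proof (cases "k = 0")
    case k: True
    obtain c where c: "Y k l = (\<lambda>x. \<Sum>\<alpha> | (\<Sum>i\<in>UNIV. \<alpha> i) = k.
        c \<alpha> * complex_of_real (\<Prod>i\<in>UNIV. x $ i ^ \<alpha> i))"
      using Y by (auto simp: harmonic_polynomials_def homogeneous_polynomial_def)
    have "Y k l x = Y k l y" for x y
      unfolding c by (intro sum.cong) (auto simp: k)
    then have "Y k l 0 = Y k l \<theta>" .
    then show ?thesis using True k by (simp add: polar_fun_def)
  qed (simp add: polar_fun_def True)
qed

end

(* Almansi decomposition by induction on the order. For h harmonic and homogeneous of degree k,
   Euler's identity gives Laplacian(|x|^(2j+2) h) = 2(j+1)(2j+2k+d) |x|^(2j) h with a nonzero factor.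
   Spanning: if f is polyharmonic of order N+1, the induction hypothesis for its Laplacian and this
   formula yield a combination F of the functions |x|^(2j) h with the same Laplacian as f; then
   f - F is harmonic, and so are its homogeneous components.
   Independence: applying the Laplacian to a vanishing sum of terms |x|^(2j) h_(k,j) lowers all
   exponents, so the terms with j > 0 vanish by induction, and those with j = 0 vanish because they
   have distinct degrees. *)
theory Submission
  imports Defs
begin

section \<open>Pointwise evaluation in the function space\<close>

lemma sum_fun_apply: "sum f A x = (\<Sum>i\<in>A. f i x)"
  by (induction A rule: infinite_finite_induct) (auto simp: plus_fun_apply zero_fun_apply)

lemma cscale_apply: "cscale c f x = c * f x"
  by (simp add: cscale_def)

text \<open>Unification eta-expands terms of function type, so a goal may contain the zero function as
  an abstraction over \<open>0 x\<close>; the pointwise rules would turn it into a form that no longer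
  matches \<open>0\<close>. They are therefore used only on demand.\<close>

lemmas fun_apply = plus_fun_apply zero_fun_apply times_fun_apply one_fun_apply cscale_apply

declare plus_fun_apply [simp del] zero_fun_apply [simp del] times_fun_apply [simp del]
  one_fun_apply [simp del]

section \<open>Complex polynomials as the span of the monomials\<close>

definition monomial_fun :: "('d \<Rightarrow> nat) \<Rightarrow> real ^ 'd::finite \<Rightarrow> complex" where
  "monomial_fun \<alpha> x = (\<Prod>i\<in>UNIV. complex_of_real (x $ i) ^ \<alpha> i)"

text \<open>The complex-valued polynomial functions, by
  \<open>polynomial_function_iff_cpoly\<close>. The form as a span gives closure under linear
  operations and an induction over monomials.\<close>

definition cpoly :: "(real ^ 'd::finite \<Rightarrow> complex) set" where
  "cpoly = cfun.span (range monomial_fun)"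

lemma subspace_cpoly: "cfun.subspace cpoly"
  by (simp add: cpoly_def)

lemmas cpoly_add = cfun.subspace_add[OF subspace_cpoly]
  and cpoly_diff = cfun.subspace_diff[OF subspace_cpoly]
  and cpoly_scale = cfun.subspace_scale[OF subspace_cpoly]
  and cpoly_zero = cfun.subspace_0[OF subspace_cpoly]
  and cpoly_sum = cfun.subspace_sum[OF subspace_cpoly]

lemma monomial_in_cpoly: "monomial_fun \<alpha> \<in> cpoly"
  by (simp add: cpoly_def cfun.span_base)

text \<open>Membership is carried along with \<open>P\<close>, so that both summands in the
  \<open>add\<close> case are known to be polynomials; linearity of derivatives is available only
  under this condition.\<close>

lemma cpoly_induct [consumes 1, case_names zero monomial add]:
  assumes "f \<in> cpoly" "P 0" "\<And>c \<alpha>. P (cscale c (monomial_fun \<alpha>))"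
    "\<And>f g. f \<in> cpoly \<Longrightarrow> g \<in> cpoly \<Longrightarrow> P f \<Longrightarrow> P g \<Longrightarrow> P (f + g)"
  shows "P f"
proof -
  have "f \<in> cpoly \<and> P f"
    using assms(1) unfolding cpoly_def
  proof (induction rule: cfun.span_induct_alt)
    case base
    then show ?case using assms(2) cpoly_zero by (simp add: cpoly_def)
  next
    case (step c x y)
    then obtain \<alpha> where x: "x = monomial_fun \<alpha>" by auto
    have "y \<in> cpoly" "P y" using step by (simp_all add: cpoly_def)
    moreover have "cscale c x \<in> cpoly" unfolding x by (intro cpoly_scale monomial_in_cpoly)
    ultimately have "cscale c x + y \<in> cpoly \<and> P (cscale c x + y)"
      using assms(3,4) cpoly_add by (simp add: x)
    then show ?case by (simp add: cpoly_def)
  qed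
  then show ?thesis by simp
qed

lemma monomial_mult: "monomial_fun \<alpha> * monomial_fun \<beta> = monomial_fun (\<lambda>i. \<alpha> i + \<beta> i)"
  by (simp add: fun_eq_iff fun_apply monomial_fun_def power_add prod.distrib)

lemma cpoly_mult:
  assumes "f \<in> cpoly" "g \<in> cpoly"
  shows "f * g \<in> cpoly"
  using assms(1)
proof (induction f rule: cpoly_induct)
  case zero
  then show ?case using cpoly_zero by simp
next
  case (monomial c \<alpha>)
  show ?case using assms(2)
  proof (induction g rule: cpoly_induct)
    case zero
    then show ?case using cpoly_zero by simp
  next
    case (monomial c' \<beta>)
    have "cscale c (monomial_fun \<alpha>) * cscale c' (monomial_fun \<beta>)
        = cscale (c * c') (monomial_fun \<alpha> * monomial_fun \<beta>)"
      by (simp add: fun_eq_iff fun_apply)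
    then show ?case by (simp add: monomial_mult cpoly_scale monomial_in_cpoly)
  next
    case (add f g)
    then show ?case by (simp add: cpoly_add distrib_left)
  qed
next
  case (add f g)
  then show ?case by (simp add: cpoly_add distrib_right)
qed

lemma cpoly_const: "(\<lambda>_. c) \<in> cpoly"
proof -
  have "cscale c (monomial_fun (\<lambda>_. 0)) \<in> cpoly"
    by (intro cpoly_scale monomial_in_cpoly)
  also have "cscale c (monomial_fun (\<lambda>_. 0)) = (\<lambda>_. c)"
    by (simp add: fun_eq_iff fun_apply monomial_fun_def)
  finally show ?thesis .
qed

lemma cpoly_component: "(\<lambda>x. complex_of_real (x $ i)) \<in> cpoly"
proof -
  have "(\<lambda>x. complex_of_real (x $ i)) = monomial_fun (\<lambda>j. if j = i then 1 else 0)"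
    by (auto simp: fun_eq_iff fun_apply monomial_fun_def if_distrib[of "\<lambda>n. _ ^ n"] prod.delta cong: if_cong)
  then show ?thesis by (simp add: monomial_in_cpoly)
qed

text \<open>A linear functional is a combination of the coordinates, by expanding its argument in
  the standard basis. The remaining generators are covered by the closure properties of
  \<open>cpoly\<close>.\<close>

lemma of_real_polynomial_in_cpoly:
  assumes "real_polynomial_function (p :: real ^ 'd::finite \<Rightarrow> real)"
  shows "(\<lambda>x. complex_of_real (p x)) \<in> cpoly"
  using assms
proof (induction rule: real_polynomial_function.induct)
  case (linear f)
  have "(\<lambda>x. complex_of_real (f x))
      = (\<Sum>i\<in>UNIV. cscale (complex_of_real (f (axis i 1))) (\<lambda>x. complex_of_real (x $ i)))"
  proof
    fix x
    have "f x = f (\<Sum>i\<in>UNIV. (x $ i) *\<^sub>R axis i 1)"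
      using basis_expansion[of x] by (simp add: scalar_mult_eq_scaleR)
    also have "\<dots> = (\<Sum>i\<in>UNIV. f (axis i 1) * x $ i)"
      using linear by (simp add: linear_sum bounded_linear.linear linear_scale mult.commute)
    finally show "complex_of_real (f x)
      = (\<Sum>i\<in>UNIV. cscale (complex_of_real (f (axis i 1))) (\<lambda>x. complex_of_real (x $ i))) x"
      by (simp add: sum_fun_apply fun_apply)
  qed
  then show ?case by (simp add: cpoly_sum cpoly_scale cpoly_component)
next
  case (const c)
  show ?case by (rule cpoly_const)
next
  case (add f g)
  then show ?case using cpoly_add[OF add.IH] by (simp add: plus_fun_def)
next
  case (mult f g)
  then show ?case using cpoly_mult[OF mult.IH] by (simp add: times_fun_def)
qed

text \<open>\<open>polynomial_function\<close> speaks about real functionals of the values. The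
  functionals \<open>Re\<close> and \<open>Im\<close> suffice to reach \<open>cpoly\<close>, since a
  complex function is recovered from its real and imaginary parts.\<close>

lemma polynomial_function_iff_cpoly:
  fixes f :: "real ^ 'd::finite \<Rightarrow> complex"
  shows "polynomial_function f \<longleftrightarrow> f \<in> cpoly"
proof
  assume f: "polynomial_function f"
  have "real_polynomial_function (Re \<circ> f)" "real_polynomial_function (Im \<circ> f)"
    using f bounded_linear_Re bounded_linear_Im by (auto simp: polynomial_function_def)
  then have *: "(\<lambda>x. complex_of_real (Re (f x))) \<in> cpoly" "(\<lambda>x. complex_of_real (Im (f x))) \<in> cpoly"
    using of_real_polynomial_in_cpoly by (force simp: o_def)+
  have "f = (\<lambda>x. complex_of_real (Re (f x))) + cscale \<i> (\<lambda>x. complex_of_real (Im (f x)))"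
    by (simp add: fun_eq_iff fun_apply complex_eq_iff)
  then show "f \<in> cpoly" using * cpoly_add cpoly_scale by metis
next
  assume "f \<in> cpoly"
  then show "polynomial_function f"
  proof (induction rule: cpoly_induct)
    case zero
    then show ?case by (simp add: zero_fun_def)
  next
    case (monomial c \<alpha>)
    have "real_polynomial_function (\<lambda>x::real ^ 'd. \<Prod>i\<in>UNIV. (x $ i) ^ \<alpha> i)"
      by (intro real_polynomial_function_prod real_polynomial_function_power
           real_polynomial_function.intros(1) bounded_linear_vec_nth) auto
    then have "polynomial_function (\<lambda>x::real ^ 'd. (\<Prod>i\<in>UNIV. (x $ i) ^ \<alpha> i) *\<^sub>R c)"
      by (simp add: polynomial_function_mult real_polynomial_function_eq)
    moreover have "cscale c (monomial_fun \<alpha>) = (\<lambda>x. (\<Prod>i\<in>UNIV. (x $ i) ^ \<alpha> i) *\<^sub>R c)"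
      by (simp add: fun_eq_iff fun_apply monomial_fun_def scaleR_conv_of_real)
    ultimately show ?case by simp
  next
    case (add f g)
    then show ?case by (simp add: plus_fun_def polynomial_function_add)
  qed
qed

section \<open>Partial derivatives and the Laplacian on polynomials\<close>

lemma cpoly_differentiable:
  assumes "f \<in> cpoly"
  shows "f differentiable (at x)"
  using assms polynomial_function_iff_cpoly differentiable_at_polynomial_function by blast

lemma cpoly_has_derivative:
  assumes "f \<in> cpoly"
  shows "(f has_derivative frechet_derivative f (at x)) (at x)"
  using cpoly_differentiable[OF assms] frechet_derivative_works by blast

lemma partial_deriv_eq:
  assumes "(f has_derivative D) (at x)"
  shows "partial_deriv i f x = D (axis i 1)"
  unfolding partial_deriv_def by (simp flip: frechet_derivative_at[OF assms])

lemma partial_deriv_add: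
  assumes "f \<in> cpoly" "g \<in> cpoly"
  shows "partial_deriv i (f + g) = partial_deriv i f + partial_deriv i g"
proof
  fix x
  show "partial_deriv i (f + g) x = (partial_deriv i f + partial_deriv i g) x"
    using partial_deriv_eq[OF has_derivative_add[OF assms[THEN cpoly_has_derivative]], of i x]
    by (simp add: plus_fun_def partial_deriv_def)
qed

lemma partial_deriv_scale:
  assumes "f \<in> cpoly"
  shows "partial_deriv i (cscale c f) = cscale c (partial_deriv i f)"
proof
  fix x
  show "partial_deriv i (cscale c f) x = cscale c (partial_deriv i f) x"
    using partial_deriv_eq[OF has_derivative_mult_right[OF cpoly_has_derivative[OF assms], where x = c], of i x]
    by (simp add: cscale_def partial_deriv_def)
qed

lemma partial_deriv_mult:
  assumes "f \<in> cpoly" "g \<in> cpoly"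
  shows "partial_deriv i (f * g) = f * partial_deriv i g + partial_deriv i f * g"
proof
  fix x
  show "partial_deriv i (f * g) x = (f * partial_deriv i g + partial_deriv i f * g) x"
    using partial_deriv_eq[OF has_derivative_mult[OF assms[THEN cpoly_has_derivative]], of i x]
    by (simp add: times_fun_def plus_fun_def partial_deriv_def)
qed

lemma partial_deriv_component:
  "partial_deriv i (\<lambda>x. complex_of_real (x $ j)) = (\<lambda>_. if i = j then 1 else 0)"
proof
  fix x
  have "((\<lambda>x. complex_of_real (x $ j)) has_derivative (\<lambda>h. complex_of_real (h $ j))) (at x)"
    by (intro derivative_intros has_derivative_of_real bounded_linear_imp_has_derivative
         bounded_linear_vec_nth)
  from partial_deriv_eq[OF this]
  show "partial_deriv i (\<lambda>x. complex_of_real (x $ j)) x = (if i = j then 1 else 0)"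
    by (simp add: axis_def)
qed

text \<open>For \<open>\<alpha> i = 0\<close> the truncated exponent \<open>\<alpha> i - 1\<close>
  is harmless, because the scalar in front vanishes.\<close>

lemma partial_deriv_monomial:
  "partial_deriv i (monomial_fun \<alpha>) =
     cscale (of_nat (\<alpha> i)) (monomial_fun (\<lambda>j. if j = i then \<alpha> i - 1 else \<alpha> j))"
proof
  fix x :: "real ^ 'a"
  let ?g = "\<lambda>i x. complex_of_real (x $ i) ^ \<alpha> i"
  have "(monomial_fun \<alpha> has_derivative (\<lambda>y. \<Sum>k\<in>UNIV. (of_nat (\<alpha> k) * complex_of_real (y $ k) *
      complex_of_real (x $ k) ^ (\<alpha> k - 1)) * (\<Prod>j\<in>UNIV - {k}. ?g j x))) (at x)"
    unfolding monomial_fun_def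
    by (rule has_derivative_prod has_derivative_power has_derivative_of_real
          bounded_linear_imp_has_derivative bounded_linear_vec_nth)+
  note partial_deriv_eq[OF this, of i]
  also have "(\<Sum>k\<in>UNIV. (of_nat (\<alpha> k) * complex_of_real (axis i 1 $ k) *
      complex_of_real (x $ k) ^ (\<alpha> k - 1)) * (\<Prod>j\<in>UNIV - {k}. ?g j x)) =
      (\<Sum>k\<in>UNIV. if k = i then of_nat (\<alpha> i) * complex_of_real (x $ i) ^ (\<alpha> i - 1)
         * (\<Prod>j\<in>UNIV - {i}. ?g j x) else 0)"
    by (intro sum.cong) (auto simp: axis_def)
  also have "\<dots> = of_nat (\<alpha> i) * (complex_of_real (x $ i) ^ (\<alpha> i - 1)
         * (\<Prod>j\<in>UNIV - {i}. ?g j x))"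
    by simp
  also have "complex_of_real (x $ i) ^ (\<alpha> i - 1) * (\<Prod>j\<in>UNIV - {i}. ?g j x)
      = monomial_fun (\<lambda>j. if j = i then \<alpha> i - 1 else \<alpha> j) x"
    unfolding monomial_fun_def by (subst prod.remove[of UNIV i]) auto
  finally show "partial_deriv i (monomial_fun \<alpha>) x =
     cscale (of_nat (\<alpha> i)) (monomial_fun (\<lambda>j. if j = i then \<alpha> i - 1 else \<alpha> j)) x"
    by (simp add: fun_apply)
qed

lemma partial_deriv_zero: "partial_deriv i 0 = 0"
  using partial_deriv_scale[OF cpoly_zero, of i 0] by (simp add: fun_eq_iff fun_apply cscale_def zero_fun_def)

lemma partial_deriv_in_cpoly:
  assumes "f \<in> cpoly"
  shows "partial_deriv i f \<in> cpoly"
  using assms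
proof (induction rule: cpoly_induct)
  case zero
  then show ?case by (simp add: partial_deriv_zero cpoly_zero)
next
  case (monomial c \<alpha>)
  then show ?case
    by (simp add: partial_deriv_scale monomial_in_cpoly partial_deriv_monomial cpoly_scale)
next
  case (add f g)
  then show ?case by (simp add: partial_deriv_add cpoly_add)
qed

lemma cpoly_times_cont_differentiable:
  assumes "f \<in> cpoly"
  shows "times_cont_differentiable n f"
  using assms
proof (induction n arbitrary: f)
  case 0
  then show ?case
    by (simp add: polynomial_function_iff_cpoly[symmetric] continuous_on_polymonial_function)
next
  case (Suc n)
  then show ?case
    by (auto simp: partial_deriv_in_cpoly differentiable_on_def cpoly_differentiable
        intro: differentiable_at_withinI)
qed

lemma laplacian_eq_sum: "laplacian f = (\<Sum>i\<in>UNIV. partial_deriv i (partial_deriv i f))"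
  by (simp add: fun_eq_iff fun_apply laplacian_def sum_fun_apply)

lemma laplacian_in_cpoly:
  "f \<in> cpoly \<Longrightarrow> laplacian f \<in> cpoly"
  by (simp add: laplacian_eq_sum cpoly_sum partial_deriv_in_cpoly)

lemma laplacian_add:
  "f \<in> cpoly \<Longrightarrow> g \<in> cpoly \<Longrightarrow> laplacian (f + g) = laplacian f + laplacian g"
  by (simp add: laplacian_eq_sum partial_deriv_add partial_deriv_in_cpoly sum.distrib)

lemma laplacian_scale:
  "f \<in> cpoly \<Longrightarrow> laplacian (cscale c f) = cscale c (laplacian f)"
  by (simp add: laplacian_eq_sum partial_deriv_scale partial_deriv_in_cpoly cfun.scale_sum_right)

lemma laplacian_zero: "laplacian 0 = 0"
  by (simp add: laplacian_eq_sum partial_deriv_zero)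

lemma laplacian_diff:
  assumes "f \<in> cpoly" "g \<in> cpoly"
  shows "laplacian (f - g) = laplacian f - laplacian g"
  using laplacian_add[of "f - g" g] assms by (simp add: cpoly_diff)

lemma laplacian_sum:
  "(\<And>i. i \<in> A \<Longrightarrow> f i \<in> cpoly) \<Longrightarrow> laplacian (\<Sum>i\<in>A. f i) = (\<Sum>i\<in>A. laplacian (f i))"
  by (induction A rule: infinite_finite_induct) (auto simp: laplacian_zero laplacian_add cpoly_sum)

section \<open>Polyharmonic polynomials\<close>

text \<open>Polynomials are smooth, so only the differential equation remains.\<close>

lemma polyharmonic_polynomials_eq:
  "polyharmonic_polynomials N = {f \<in> cpoly. (laplacian ^^ N) f = 0}"
  by (auto simp: polyharmonic_polynomials_def polyharmonic_def polynomial_function_iff_cpoly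
      cpoly_times_cont_differentiable zero_fun_def)

lemma polyharmonic_polynomials_0: "polyharmonic_polynomials 0 = {0}"
  by (auto simp: polyharmonic_polynomials_eq cpoly_zero)

text \<open>The Laplacian applied first is split off; this recursion drives the inductions on the
  order.\<close>

lemma polyharmonic_polynomials_Suc_iff:
  "f \<in> polyharmonic_polynomials (Suc N) \<longleftrightarrow> f \<in> cpoly \<and> laplacian f \<in> polyharmonic_polynomials N"
  by (auto simp: polyharmonic_polynomials_eq laplacian_in_cpoly funpow_swap1)

lemma subspace_polyharmonic_polynomials: "cfun.subspace (polyharmonic_polynomials N)"
proof (induction N)
  case 0
  then show ?case by (simp add: polyharmonic_polynomials_0 cfun.subspace_single_0)
next
  case (Suc N)
  then show ?case
    by (auto simp: cfun.subspace_def polyharmonic_polynomials_Suc_iff cpoly_zero cpoly_add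
        cpoly_scale laplacian_zero laplacian_add laplacian_scale)
qed

section \<open>Homogeneous polynomials and homogeneous components\<close>

lemma homogeneous_in_cpoly:
  assumes "homogeneous_polynomial k f"
  shows "f \<in> cpoly"
proof -
  from assms obtain c where
    "f = (\<lambda>x. \<Sum>\<alpha> | (\<Sum>i\<in>UNIV. \<alpha> i) = k. c \<alpha> * complex_of_real (\<Prod>i\<in>UNIV. x $ i ^ \<alpha> i))"
    by (auto simp: homogeneous_polynomial_def)
  then have "f = (\<Sum>\<alpha> | (\<Sum>i\<in>UNIV. \<alpha> i) = k. cscale (c \<alpha>) (monomial_fun \<alpha>))"
    by (simp add: fun_eq_iff fun_apply sum_fun_apply fun_apply monomial_fun_def)
  then show ?thesis by (simp add: cpoly_sum cpoly_scale monomial_in_cpoly)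
qed

lemma homogeneous_apply_scale:
  assumes "homogeneous_polynomial k f"
  shows "f (t *\<^sub>R x) = of_real t ^ k * f x"
proof -
  from assms obtain c where
    f: "f = (\<lambda>x. \<Sum>\<alpha> | (\<Sum>i\<in>UNIV. \<alpha> i) = k. c \<alpha> * complex_of_real (\<Prod>i\<in>UNIV. x $ i ^ \<alpha> i))"
    by (auto simp: homogeneous_polynomial_def)
  show ?thesis
    unfolding f sum_distrib_left
    by (intro sum.cong) (auto simp: power_mult_distrib prod.distrib power_sum)
qed

text \<open>Each entry of a multi-index is at most its total degree. Finiteness matters because a
  sum over an infinite index set would default to 0.\<close>

lemma finite_multiindices: "finite {\<alpha> :: 'd::finite \<Rightarrow> nat. (\<Sum>i\<in>UNIV. \<alpha> i) = k}"
proof (rule finite_subset)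
  show "{\<alpha> :: 'd \<Rightarrow> nat. (\<Sum>i\<in>UNIV. \<alpha> i) = k} \<subseteq> UNIV \<rightarrow>\<^sub>E {..k}"
    by (auto intro!: member_le_sum)
  show "finite ((UNIV :: 'd set) \<rightarrow>\<^sub>E {..k})"
    by (intro finite_PiE) auto
qed

lemma homogeneous_zero: "homogeneous_polynomial k 0"
  unfolding homogeneous_polynomial_def
  by (rule exI[of _ "\<lambda>_. 0"]) (simp add: zero_fun_def)

lemma homogeneous_add:
  assumes "homogeneous_polynomial k f" "homogeneous_polynomial k g"
  shows "homogeneous_polynomial k (f + g)"
proof -
  from assms obtain c c' where
    "f = (\<lambda>x. \<Sum>\<alpha> | (\<Sum>i\<in>UNIV. \<alpha> i) = k. c \<alpha> * complex_of_real (\<Prod>i\<in>UNIV. x $ i ^ \<alpha> i))"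
    "g = (\<lambda>x. \<Sum>\<alpha> | (\<Sum>i\<in>UNIV. \<alpha> i) = k. c' \<alpha> * complex_of_real (\<Prod>i\<in>UNIV. x $ i ^ \<alpha> i))"
    unfolding homogeneous_polynomial_def by blast
  then show ?thesis
    unfolding homogeneous_polynomial_def
    by (intro exI[of _ "\<lambda>\<alpha>. c \<alpha> + c' \<alpha>"]) (simp add: fun_eq_iff fun_apply sum.distrib distrib_right)
qed

lemma homogeneous_monomial: "homogeneous_polynomial (\<Sum>i\<in>UNIV. \<alpha> i) (cscale c (monomial_fun \<alpha>))"
  unfolding homogeneous_polynomial_def
proof (intro exI[of _ "\<lambda>\<beta>. if \<beta> = \<alpha> then c else 0"] ext)
  fix x
  have "(\<Sum>\<beta> | sum \<beta> UNIV = sum \<alpha> UNIV. (if \<beta> = \<alpha> then c else 0) *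
        complex_of_real (\<Prod>i\<in>UNIV. x $ i ^ \<beta> i))
      = (\<Sum>\<beta> | sum \<beta> UNIV = sum \<alpha> UNIV. if \<beta> = \<alpha> then c * monomial_fun \<alpha> x else 0)"
    by (intro sum.cong) (auto simp: monomial_fun_def)
  also have "\<dots> = c * monomial_fun \<alpha> x"
    by (simp add: sum.delta' finite_multiindices)
  finally show "cscale c (monomial_fun \<alpha>) x = (\<Sum>\<beta> | sum \<beta> UNIV = sum \<alpha> UNIV.
      (if \<beta> = \<alpha> then c else 0) * complex_of_real (\<Prod>i\<in>UNIV. x $ i ^ \<beta> i))"
    by (simp add: fun_apply)
qed

lemma homogeneous_decomposition:
  assumes "f \<in> cpoly"
  obtains F n where "\<And>m. homogeneous_polynomial m (F m)" "f = (\<Sum>m\<le>n. F m)"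
proof -
  \<comment> \<open>Demanding the equation for all large \<open>n\<close> lets two decompositions
    with different bounds be added at their maximum.\<close>
  have "\<exists>F n0. (\<forall>m. homogeneous_polynomial m (F m)) \<and> (\<forall>n\<ge>n0. f = (\<Sum>m\<le>n. F m))"
    using assms
  proof (induction rule: cpoly_induct)
    case zero
    then show ?case by (intro exI[of _ "\<lambda>_. 0"]) (auto simp: homogeneous_zero)
  next
    case (monomial c \<alpha>)
    let ?F = "\<lambda>m. if m = (\<Sum>i\<in>UNIV. \<alpha> i) then cscale c (monomial_fun \<alpha>) else 0"
    show ?case
      by (intro exI[of _ ?F] exI[of _ "\<Sum>i\<in>UNIV. \<alpha> i"])
        (auto simp: homogeneous_monomial homogeneous_zero)
  next
    case (add f g)
    then obtain F n0 G n1 where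
      "\<forall>m. homogeneous_polynomial m (F m)" "\<forall>n\<ge>n0. f = (\<Sum>m\<le>n. F m)"
      "\<forall>m. homogeneous_polynomial m (G m)" "\<forall>n\<ge>n1. g = (\<Sum>m\<le>n. G m)"
      by metis
    then show ?case
      by (intro exI[of _ "\<lambda>m. F m + G m"] exI[of _ "max n0 n1"])
        (auto simp: homogeneous_add sum.distrib)
  qed
  then show ?thesis using that by blast
qed

text \<open>A polynomial with a nonzero coefficient has finitely many complex roots, but here every
  real number is a root.\<close>

lemma power_coefficients_zero:
  fixes a :: "nat \<Rightarrow> complex"
  assumes "\<And>t :: real. (\<Sum>m\<le>n. of_real t ^ m * a m) = 0" and "m \<le> n"
  shows "a m = 0"
proof (rule ccontr)
  assume "a m \<noteq> 0"
  then have "finite {z. (\<Sum>i\<le>n. a i * z ^ i) = 0}"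
    using assms(2) by (auto simp: polyfun_finite_roots)
  moreover have "range complex_of_real \<subseteq> {z. (\<Sum>i\<le>n. a i * z ^ i) = 0}"
    using assms(1) by (auto simp: mult.commute)
  ultimately have "finite (range complex_of_real)" by (rule rev_finite_subset)
  then have "finite (UNIV :: real set)" by (rule finite_imageD) (simp add: inj_of_real)
  then show False using infinite_UNIV_char_0 by blast
qed

text \<open>Along the ray through \<open>x\<close>, the sum is a polynomial in the scaling parameter
  t with coefficients \<open>F m x\<close>, and it vanishes for all real t.\<close>

lemma homogeneous_sum_zero:
  assumes "\<And>m. homogeneous_polynomial m (F m)" "(\<Sum>m\<le>n. F m) = 0" "m \<le> n"
  shows "F m = 0"
proof
  fix x
  have "(\<Sum>m\<le>n. of_real t ^ m * F m x) = 0" for t :: real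
  proof -
    have "(\<Sum>m\<le>n. of_real t ^ m * F m x) = (\<Sum>m\<le>n. F m) (t *\<^sub>R x)"
      by (simp add: sum_fun_apply homogeneous_apply_scale[OF assms(1)])
    then show ?thesis by (simp add: assms(2) fun_apply)
  qed
  then show "F m x = 0 x"
    using power_coefficients_zero[where n = n and a = "\<lambda>m. F m x"] assms(3) by (simp add: fun_apply)
qed

text \<open>Writing the degree shift on the left avoids a case distinction for degrees below the order
  of differentiation, where the derivative vanishes.\<close>

lemma partial_deriv_homogeneous:
  assumes f: "f \<in> cpoly" and hom: "\<And>x. of_real t ^ a * f (t *\<^sub>R x) = of_real t ^ m * f x"
  shows "of_real t ^ Suc a * partial_deriv i f (t *\<^sub>R x) = of_real t ^ m * partial_deriv i f x"
proof -
  let ?D = "frechet_derivative f (at (t *\<^sub>R x))"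
  have D: "(f has_derivative ?D) (at (t *\<^sub>R x))"
    by (rule cpoly_has_derivative[OF f])
  \<comment> \<open>The chain rule differentiates the left side of \<open>hom\<close>; the right
    side is a scalar multiple of \<open>f\<close>, so comparing the two derivatives gives the
    claim.\<close>
  have "((\<lambda>x. of_real t ^ a * f (t *\<^sub>R x)) has_derivative (\<lambda>h. of_real t ^ a * ?D (t *\<^sub>R h))) (at x)"
    by (intro has_derivative_mult_right has_derivative_compose[where f = "\<lambda>x. t *\<^sub>R x", OF _ D]
        bounded_linear_imp_has_derivative bounded_linear_scaleR_right)
  from partial_deriv_eq[OF this, of i]
  have "partial_deriv i (cscale (of_real t ^ m) f) x = of_real t ^ a * ?D (t *\<^sub>R axis i 1)"
    by (simp add: hom cscale_def)
  also have "?D (t *\<^sub>R axis i 1) = of_real t * partial_deriv i f (t *\<^sub>R x)"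
    using has_derivative_linear[OF D]
    by (simp add: linear_scale partial_deriv_def scaleR_conv_of_real[where 'a = complex])
  finally have "cscale (of_real t ^ m) (partial_deriv i f) x
      = of_real t ^ a * (of_real t * partial_deriv i f (t *\<^sub>R x))"
    unfolding partial_deriv_scale[OF f] .
  then show ?thesis by (simp add: cscale_apply)
qed

text \<open>Two applications of \<open>partial_deriv_homogeneous\<close>, starting from
  \<open>a = 0\<close>, raise the power of t on the left to 2.\<close>

lemma laplacian_homogeneous:
  assumes "homogeneous_polynomial m f"
  shows "of_real t ^ 2 * laplacian f (t *\<^sub>R x) = of_real t ^ m * laplacian f x"
proof -
  note f = homogeneous_in_cpoly[OF assms]
  have "of_real t ^ Suc 0 * partial_deriv i f (t *\<^sub>R x) = of_real t ^ m * partial_deriv i f x" for i x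
    by (rule partial_deriv_homogeneous[OF f]) (simp add: homogeneous_apply_scale[OF assms])
  then have "of_real t ^ Suc (Suc 0) * partial_deriv i (partial_deriv i f) (t *\<^sub>R x)
      = of_real t ^ m * partial_deriv i (partial_deriv i f) x" for i x
    by (rule partial_deriv_homogeneous[OF partial_deriv_in_cpoly[OF f]])
  then show ?thesis by (simp add: laplacian_def sum_distrib_left power2_eq_square)
qed

section \<open>Harmonic polynomials and their homogeneous components\<close>

lemma harmonic_polynomials_eq:
  "harmonic_polynomials k = {f. homogeneous_polynomial k f \<and> laplacian f = 0}"
  by (auto simp: harmonic_polynomials_def polyharmonic_def homogeneous_in_cpoly
      cpoly_times_cont_differentiable zero_fun_def)

text \<open>The Laplacian lowers every degree by the same amount, so the Laplacians of different
  components cannot cancel and each component is itself harmonic.\<close>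

lemma harmonic_decomposition:
  assumes "f \<in> cpoly" "laplacian f = 0"
  shows "f \<in> cfun.span (\<Union>k. harmonic_polynomials k)"
proof -
  obtain F n where F: "\<And>m. homogeneous_polynomial m (F m)" and f: "f = (\<Sum>m\<le>n. F m)"
    using homogeneous_decomposition[OF assms(1)] by blast
  have "laplacian (F m) x = 0" if "m \<le> n" for m x
  proof (rule power_coefficients_zero[where n = n, OF _ that])
    fix t :: real
    \<comment> \<open>The scaling law turns the polynomial in t with coefficients
      \<open>laplacian (F m) x\<close> into a multiple of the Laplacian of \<open>f\<close> at
      \<open>t *\<^sub>R x\<close>, which is zero.\<close>
    have "(\<Sum>m\<le>n. of_real t ^ m * laplacian (F m) x)
        = of_real t ^ 2 * (\<Sum>m\<le>n. laplacian (F m)) (t *\<^sub>R x)"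
      by (simp add: laplacian_homogeneous[OF F, symmetric] sum_distrib_left sum_fun_apply fun_apply)
    also have "(\<Sum>m\<le>n. laplacian (F m)) = 0"
      using assms(2) by (simp add: f laplacian_sum homogeneous_in_cpoly[OF F])
    finally show "(\<Sum>m\<le>n. of_real t ^ m * laplacian (F m) x) = 0" by (simp add: fun_apply)
  qed
  then have "F m \<in> harmonic_polynomials m" if "m \<le> n" for m
    using that F by (auto simp: harmonic_polynomials_eq fun_eq_iff fun_apply)
  then show ?thesis unfolding f by (intro cfun.span_sum cfun.span_base) auto
qed

section \<open>The Laplacian of a power of the squared norm times a harmonic polynomial\<close>

text \<open>Complex-valued, so that \<open>norm_sq ^ j\<close> in the algebra of functions is the
  factor \<open>|x|\<close> to the power 2j.\<close>

definition norm_sq :: "real ^ 'd::finite \<Rightarrow> complex" where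
  "norm_sq x = complex_of_real (norm x ^ 2)"

lemma norm_sq_eq: "norm_sq = (\<Sum>i\<in>UNIV. (\<lambda>x. complex_of_real (x $ i)) * (\<lambda>x. complex_of_real (x $ i)))"
  by (simp add: fun_eq_iff fun_apply norm_sq_def sum_fun_apply norm_vec_def L2_set_def sum_nonneg power2_eq_square)

lemma norm_sq_in_cpoly: "norm_sq \<in> cpoly"
  unfolding norm_sq_eq by (intro cpoly_sum cpoly_mult cpoly_component)

lemma cpoly_power: "f \<in> cpoly \<Longrightarrow> f ^ j \<in> cpoly"
proof (induction j)
  case 0
  then show ?case using cpoly_const[of 1] by (simp add: one_fun_def)
qed (simp add: cpoly_mult)

lemma partial_deriv_sum:
  "(\<And>i. i \<in> A \<Longrightarrow> f i \<in> cpoly) \<Longrightarrow> partial_deriv j (\<Sum>i\<in>A. f i) = (\<Sum>i\<in>A. partial_deriv j (f i))"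
  by (induction A rule: infinite_finite_induct)
    (auto simp: partial_deriv_zero partial_deriv_add cpoly_sum)

lemma partial_deriv_norm_sq: "partial_deriv i norm_sq = cscale 2 (\<lambda>x. complex_of_real (x $ i))"
proof
  fix x :: "real ^ 'a"
  have "partial_deriv i norm_sq x = (\<Sum>j\<in>UNIV. if i = j then 2 * complex_of_real (x $ j) else 0)"
    unfolding norm_sq_eq
    by (subst partial_deriv_sum)
      (auto simp: cpoly_mult cpoly_component sum_fun_apply partial_deriv_mult fun_apply
        partial_deriv_component if_distrib[of "\<lambda>c. _ * c"] cong: if_cong)
  then show "partial_deriv i norm_sq x = cscale 2 (\<lambda>x. complex_of_real (x $ i)) x"
    by (simp add: fun_apply)
qed

text \<open>Product rule: the squared norm has Laplacian 2d and gradient 2x, so the doubled cross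
  term is 4 times the Euler operator applied to \<open>g\<close>.\<close>

lemma laplacian_norm_sq_mult:
  fixes g :: "real ^ 'd::finite \<Rightarrow> complex"
  assumes g: "g \<in> cpoly"
  shows "laplacian (norm_sq * g) x = 2 * of_nat CARD('d) * g x
    + 4 * (\<Sum>i\<in>UNIV. complex_of_real (x $ i) * partial_deriv i g x) + norm_sq x * laplacian g x"
proof -
  let ?c = "\<lambda>i x. complex_of_real (x $ i)"
  have "partial_deriv i (norm_sq * g) = norm_sq * partial_deriv i g + cscale 2 (?c i) * g" for i
    by (simp add: partial_deriv_mult norm_sq_in_cpoly g partial_deriv_norm_sq)
  then have "partial_deriv i (partial_deriv i (norm_sq * g)) x = 2 * g x
      + 4 * (?c i x * partial_deriv i g x) + norm_sq x * partial_deriv i (partial_deriv i g) x" for i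
    by (simp add: partial_deriv_add partial_deriv_mult norm_sq_in_cpoly g partial_deriv_norm_sq
        partial_deriv_in_cpoly cpoly_mult cpoly_scale cpoly_component partial_deriv_scale
        partial_deriv_component fun_apply)
  then show ?thesis
    by (simp add: laplacian_def sum.distrib sum_distrib_left)
qed

text \<open>The function sending t to \<open>f (t *\<^sub>R x)\<close> is differentiated at t = 1 in
  two ways: by the chain rule and through the power of t.\<close>

lemma euler_homogeneous:
  assumes f: "f \<in> cpoly" and hom: "\<And>t x. f (t *\<^sub>R x) = of_real t ^ k * f x"
  shows "(\<Sum>i\<in>UNIV. complex_of_real (x $ i) * partial_deriv i f x) = of_nat k * f x"
proof -
  let ?D = "frechet_derivative f (at x)"
  \<comment> \<open>The base point is written as \<open>1 *\<^sub>R x\<close> to fit the chain rule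
    below.\<close>
  have D: "(f has_derivative ?D) (at ((1::real) *\<^sub>R x))"
    using cpoly_has_derivative[OF f] by simp
  have "((\<lambda>t::real. f (t *\<^sub>R x)) has_derivative (\<lambda>s. ?D (s *\<^sub>R x))) (at 1)"
    by (intro has_derivative_compose[where f = "\<lambda>t. t *\<^sub>R x", OF _ D] bounded_linear_imp_has_derivative
        bounded_linear_scaleR_left)
  moreover have "((\<lambda>t::real. f (t *\<^sub>R x)) has_derivative
      (\<lambda>s. of_nat k * of_real s * of_real 1 ^ (k - 1) * f x)) (at 1)"
    unfolding hom
    by (intro has_derivative_mult_left has_derivative_power has_derivative_of_real has_derivative_ident)
  ultimately have "(\<lambda>s. ?D (s *\<^sub>R x)) = (\<lambda>s. of_nat k * of_real s * of_real 1 ^ (k - 1) * f x)"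
    by (rule has_derivative_unique)
  then have "?D ((1::real) *\<^sub>R x) = of_nat k * of_real 1 * of_real 1 ^ (k - 1) * f x" by (rule fun_cong)
  then have "of_nat k * f x = ?D x" by simp
  also have "?D x = ?D (\<Sum>i\<in>UNIV. (x $ i) *\<^sub>R axis i 1)"
    using basis_expansion[of x] by (simp add: scalar_mult_eq_scaleR)
  also have "\<dots> = (\<Sum>i\<in>UNIV. complex_of_real (x $ i) * partial_deriv i f x)"
    using has_derivative_linear[OF D]
    by (simp add: linear_sum linear_scale partial_deriv_def scaleR_conv_of_real[where 'a = complex])
  finally show ?thesis by simp
qed

text \<open>One factor \<open>norm_sq\<close> is split off; the cross term is evaluated by Euler's
  identity in degree k + 2j and the last term by induction. The factors add up: c_j = 2j(2j - 2 + 2k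
  + d) satisfies c_(j+1) = c_j + 2d + 4(k + 2j).\<close>

lemma laplacian_norm_sq_power_mult:
  fixes h :: "real ^ 'd::finite \<Rightarrow> complex"
  assumes "h \<in> harmonic_polynomials k"
  shows "laplacian (norm_sq ^ Suc j * h)
    = cscale (of_nat (2 * Suc j * (2 * j + 2 * k + CARD('d)))) (norm_sq ^ j * h)"
proof -
  have h: "h \<in> cpoly" "laplacian h = 0" "\<And>t x. h (t *\<^sub>R x) = of_real t ^ k * h x"
    using assms homogeneous_apply_scale by (auto simp: harmonic_polynomials_eq homogeneous_in_cpoly)
  have p: "(norm_sq ^ j) x = norm_sq x ^ j" for j and x :: "real ^ 'd"
    by (induction j) (auto simp: fun_apply)
  have g: "norm_sq ^ j * h \<in> cpoly" for j
    by (intro cpoly_mult cpoly_power norm_sq_in_cpoly h)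
  have "(norm_sq ^ j * h) (t *\<^sub>R x) = of_real t ^ (k + 2 * j) * (norm_sq ^ j * h) x" for j t x
    by (simp add: p h(3) norm_sq_def fun_apply power_mult_distrib power_add power_mult flip: of_real_power)
  from euler_homogeneous[OF g this]
  have step: "laplacian (norm_sq * (norm_sq ^ j * h)) x = 2 * of_nat CARD('d) * (norm_sq ^ j * h) x
    + 4 * (of_nat (k + 2 * j) * (norm_sq ^ j * h) x) + norm_sq x * laplacian (norm_sq ^ j * h) x" for j x
    by (simp only: laplacian_norm_sq_mult[OF g])
  show ?thesis
  proof (induction j)
    case 0
    show ?case
    proof
      fix x
      have "laplacian (norm_sq ^ Suc 0 * h) x = laplacian (norm_sq * (norm_sq ^ 0 * h)) x"
        by simp
      also have "\<dots> = cscale (of_nat (2 * Suc 0 * (2 * 0 + 2 * k + CARD('d)))) (norm_sq ^ 0 * h) x"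
        unfolding step by (simp add: h(2) fun_apply algebra_simps)
      finally show "laplacian (norm_sq ^ Suc 0 * h) x
        = cscale (of_nat (2 * Suc 0 * (2 * 0 + 2 * k + CARD('d)))) (norm_sq ^ 0 * h) x" .
    qed
  next
    case (Suc j)
    show ?case
    proof
      fix x
      have "laplacian (norm_sq ^ Suc (Suc j) * h) x
        = laplacian (norm_sq * (norm_sq ^ Suc j * h)) x"
        by (simp add: mult.assoc)
      also have "\<dots> = cscale (of_nat (2 * Suc (Suc j) * (2 * Suc j + 2 * k + CARD('d))))
          (norm_sq ^ Suc j * h) x"
        unfolding step Suc.IH by (simp add: p fun_apply algebra_simps)
      finally show "laplacian (norm_sq ^ Suc (Suc j) * h) x
        = cscale (of_nat (2 * Suc (Suc j) * (2 * Suc j + 2 * k + CARD('d)))) (norm_sq ^ Suc j * h) x" .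
    qed
  qed
qed

lemma harmonic_in_cpoly: "h \<in> harmonic_polynomials k \<Longrightarrow> h \<in> cpoly"
  by (auto simp: harmonic_polynomials_eq homogeneous_in_cpoly)

lemma norm_sq_power_mult_in_cpoly: "h \<in> harmonic_polynomials k \<Longrightarrow> norm_sq ^ j * h \<in> cpoly"
  by (intro cpoly_mult cpoly_power norm_sq_in_cpoly harmonic_in_cpoly)

section \<open>Almansi decomposition: the spanning property\<close>

definition almansi_terms :: "nat \<Rightarrow> (real ^ 'd::finite \<Rightarrow> complex) set" where
  "almansi_terms N = {norm_sq ^ j * h | j h k. j < N \<and> h \<in> harmonic_polynomials k}"

text \<open>Each Laplacian lowers the exponent \<open>j\<close> by one up to a scalar, and the term
  with exponent 0 is harmonic.\<close>

lemma norm_sq_power_mult_polyharmonic: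
  assumes "h \<in> harmonic_polynomials k" "j < N"
  shows "norm_sq ^ j * h \<in> polyharmonic_polynomials N"
  using assms(2)
proof (induction N arbitrary: j)
  case (Suc N)
  have "laplacian (norm_sq ^ j * h) \<in> polyharmonic_polynomials N"
  proof (cases j)
    case 0
    then show ?thesis using assms(1) cfun.subspace_0[OF subspace_polyharmonic_polynomials]
      by (simp add: harmonic_polynomials_eq)
  next
    case (Suc i)
    have "norm_sq ^ i * h \<in> polyharmonic_polynomials N" using Suc.IH[of i] Suc.prems Suc by simp
    then show ?thesis
      unfolding Suc laplacian_norm_sq_power_mult[OF assms(1)]
      by (rule cfun.subspace_scale[OF subspace_polyharmonic_polynomials])
  qed
  then show ?case
    using norm_sq_power_mult_in_cpoly[OF assms(1)] by (simp add: polyharmonic_polynomials_Suc_iff)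
qed simp

text \<open>On a generator, the exponent is raised by one and the result divided by the factor from
  \<open>laplacian_norm_sq_power_mult\<close>; linearity extends this to the span.\<close>

lemma almansi_antiderivative:
  assumes "g \<in> cfun.span (almansi_terms N)"
  shows "\<exists>F \<in> cfun.span (almansi_terms (Suc N)). F \<in> cpoly \<and> laplacian F = g"
  using assms
proof (induction rule: cfun.span_induct_alt)
  case base
  then show ?case using cfun.span_zero cpoly_zero laplacian_zero by blast
next
  case (step c u g)
  then obtain F where F: "F \<in> cfun.span (almansi_terms (Suc N))" "F \<in> cpoly" "laplacian F = g"
    by blast
  obtain j h k where u: "u = norm_sq ^ j * h" "j < N" and h: "h \<in> harmonic_polynomials k"
    using step by (auto simp: almansi_terms_def)
  let ?q = "of_nat (2 * Suc j * (2 * j + 2 * k + CARD('a))) :: complex"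
  \<comment> \<open>As a natural number the factor is positive, since the dimension is.\<close>
  have "?q \<noteq> 0" unfolding of_nat_eq_0_iff by simp
  let ?G = "cscale (c / ?q) (norm_sq ^ Suc j * h)"
  have G: "norm_sq ^ Suc j * h \<in> cpoly" by (rule norm_sq_power_mult_in_cpoly[OF h])
  have "laplacian ?G = cscale c u"
    unfolding laplacian_scale[OF G] laplacian_norm_sq_power_mult[OF h] u(1)
    using \<open>?q \<noteq> 0\<close> by (simp del: of_nat_mult of_nat_add)
  moreover have "norm_sq ^ Suc j * h \<in> almansi_terms (Suc N)"
    unfolding almansi_terms_def using u(2) h by blast
  then have "?G \<in> cfun.span (almansi_terms (Suc N))"
    by (intro cfun.span_scale cfun.span_base)
  ultimately show ?case using F G
    by (intro bexI[of _ "?G + F"]) (auto simp: cpoly_add cpoly_scale laplacian_add cfun.span_add)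
qed

lemma polyharmonic_in_span_almansi:
  assumes "f \<in> polyharmonic_polynomials N"
  shows "f \<in> cfun.span (almansi_terms N)"
  using assms
proof (induction N arbitrary: f)
  case 0
  then show ?case by (simp add: polyharmonic_polynomials_0 cfun.span_zero)
next
  case (Suc N)
  then have f: "f \<in> cpoly" and "laplacian f \<in> polyharmonic_polynomials N"
    by (auto simp: polyharmonic_polynomials_Suc_iff)
  then obtain F where F: "F \<in> cfun.span (almansi_terms (Suc N))" "F \<in> cpoly" "laplacian F = laplacian f"
    using Suc.IH almansi_antiderivative by metis
  have "f - F \<in> cfun.span (\<Union>k. harmonic_polynomials k)"
    by (rule harmonic_decomposition) (simp_all add: f F cpoly_diff laplacian_diff)
  moreover have "(\<Union>k. harmonic_polynomials k) \<subseteq> almansi_terms (Suc N)"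
  proof safe
    fix k h assume h: "h \<in> harmonic_polynomials k"
    have "h = norm_sq ^ 0 * h" by simp
    then show "h \<in> almansi_terms (Suc N)" unfolding almansi_terms_def using h by blast
  qed
  ultimately have "f - F \<in> cfun.span (almansi_terms (Suc N))"
    using cfun.span_mono by blast
  from cfun.span_add[OF this F(1)] show ?case by simp
qed

lemma polyharmonic_polynomials_eq_span:
  "polyharmonic_polynomials N = cfun.span (almansi_terms N)"
proof (rule antisym)
  show "cfun.span (almansi_terms N) \<subseteq> polyharmonic_polynomials N"
    by (rule cfun.span_minimal[OF _ subspace_polyharmonic_polynomials])
      (auto simp: almansi_terms_def norm_sq_power_mult_polyharmonic)
qed (use polyharmonic_in_span_almansi in blast)

section \<open>Almansi decomposition: independence\<close>

lemma harmonic_scale: "h \<in> harmonic_polynomials k \<Longrightarrow> cscale c h \<in> harmonic_polynomials k"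
proof -
  assume h: "h \<in> harmonic_polynomials k"
  then obtain a where
    "h = (\<lambda>x. \<Sum>\<alpha> | (\<Sum>i\<in>UNIV. \<alpha> i) = k. a \<alpha> * complex_of_real (\<Prod>i\<in>UNIV. x $ i ^ \<alpha> i))"
    by (auto simp: harmonic_polynomials_eq homogeneous_polynomial_def)
  then have "homogeneous_polynomial k (cscale c h)"
    unfolding homogeneous_polynomial_def
    by (intro exI[of _ "\<lambda>\<alpha>. c * a \<alpha>"]) (simp add: fun_eq_iff fun_apply sum_distrib_left mult.assoc)
  then show ?thesis using h
    by (auto simp: harmonic_polynomials_eq laplacian_scale homogeneous_in_cpoly)
qed

lemma subspace_harmonic: "cfun.subspace (harmonic_polynomials k)"
proof (rule cfun.subspaceI)
  show "0 \<in> harmonic_polynomials k"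
    by (simp add: harmonic_polynomials_eq homogeneous_zero laplacian_zero)
next
  fix f g :: "real ^ 'a \<Rightarrow> complex"
  assume fg: "f \<in> harmonic_polynomials k" "g \<in> harmonic_polynomials k"
  then show "f + g \<in> harmonic_polynomials k"
    by (simp add: harmonic_polynomials_eq homogeneous_add laplacian_add[OF fg[THEN harmonic_in_cpoly]])
qed (rule harmonic_scale)

text \<open>Each pair of a degree up to \<open>K\<close> and an exponent below \<open>N\<close>
  carries one harmonic coefficient, possibly zero, so any finite relation takes this shape after
  grouping. The induction is general in \<open>h\<close> because the Laplacian rescales these
  coefficients.\<close>

lemma almansi_terms_independent:
  assumes "\<And>k j. h k j \<in> harmonic_polynomials k"
    and "(\<Sum>j<N. \<Sum>k\<le>K. norm_sq ^ j * h k j) = 0" and "k \<le> K" "j < N"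
  shows "h k j = (0 :: real ^ 'd::finite \<Rightarrow> complex)"
  using assms
proof (induction N arbitrary: h j k)
  case (Suc N)
  note h = Suc.prems(1)
  let ?q = "\<lambda>k j. of_nat (2 * Suc j * (2 * j + 2 * k + CARD('d))) :: complex"
  \<comment> \<open>The terms with exponent 0 are separated; all others have an exponent of the form
    \<open>Suc j\<close>, to which the Laplacian formula applies.\<close>
  have split: "(\<Sum>k\<le>K. h k 0) + (\<Sum>j<N. \<Sum>k\<le>K. norm_sq ^ Suc j * h k (Suc j)) = 0"
    using Suc.prems(2) by (simp add: sum.lessThan_Suc_shift del: power_Suc sum.lessThan_Suc)
  \<comment> \<open>The scalar is moved onto the harmonic factor, so that the differentiated
    relation matches the induction hypothesis.\<close>
  have lap: "laplacian (norm_sq ^ Suc j * h k (Suc j)) = norm_sq ^ j * cscale (?q k j) (h k (Suc j))"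
    for j k
    unfolding laplacian_norm_sq_power_mult[OF h] by (simp add: fun_eq_iff fun_apply)
  have "0 = laplacian ((\<Sum>k\<le>K. h k 0) + (\<Sum>j<N. \<Sum>k\<le>K. norm_sq ^ Suc j * h k (Suc j)))"
    by (simp only: split laplacian_zero)
  also have "\<dots> = (\<Sum>k\<le>K. laplacian (h k 0))
      + (\<Sum>j<N. \<Sum>k\<le>K. laplacian (norm_sq ^ Suc j * h k (Suc j)))"
    using norm_sq_power_mult_in_cpoly[OF h] harmonic_in_cpoly[OF h]
    by (simp add: laplacian_add laplacian_sum cpoly_sum del: power_Suc)
  also have "(\<Sum>k\<le>K. laplacian (h k 0)) = 0"
    using h by (simp add: harmonic_polynomials_eq)
  finally have lower: "(\<Sum>j<N. \<Sum>k\<le>K. norm_sq ^ j * cscale (?q k j) (h k (Suc j))) = 0"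
    unfolding lap by simp
  have "cscale (?q k j) (h k (Suc j)) = 0" if "k \<le> K" "j < N" for k j
    by (rule Suc.IH[where h = "\<lambda>k j. cscale (?q k j) (h k (Suc j))",
          OF harmonic_scale[OF h] lower that])
  moreover have "?q k j \<noteq> 0" for k j unfolding of_nat_eq_0_iff by simp
  ultimately have pos: "h k (Suc j) = 0" if "k \<le> K" "j < N" for k j
    using that by (simp add: cfun.scale_eq_0_iff del: of_nat_mult of_nat_add)
  with split have sum0: "(\<Sum>k\<le>K. h k 0) = 0" by simp
  have "homogeneous_polynomial k (h k 0)" for k
    using h[of k 0] by (simp add: harmonic_polynomials_eq)
  then have "h k 0 = 0" if "k \<le> K" for k
    by (rule homogeneous_sum_zero[where F = "\<lambda>k. h k 0", OF _ sum0 that])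
  then show ?case using pos Suc.prems(3,4) by (cases j) auto
qed simp

section \<open>Linear independence of indexed families\<close>

text \<open>Relations over finite index sets also detect repetitions: two indices with the same
  vector would give a relation with coefficients 1 and -1.\<close>

lemma independent_familyI:
  assumes "\<And>J c. finite J \<Longrightarrow> J \<subseteq> I \<Longrightarrow> (\<Sum>i\<in>J. cscale (c i) (v i)) = 0 \<Longrightarrow> \<forall>i\<in>J. c i = 0"
  shows "inj_on v I \<and> \<not> cfun.dependent (v ` I)"
proof
  show inj: "inj_on v I"
  proof (rule inj_onI, rule ccontr)
    fix i j assume ij: "i \<in> I" "j \<in> I" "v i = v j" "i \<noteq> j"
    then have "(\<Sum>m\<in>{i, j}. cscale (if m = i then 1 else - 1) (v m)) = 0"
      by (simp add: cfun.scale_minus_left)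
    then have "\<forall>m\<in>{i, j}. (if m = i then 1 else - 1 :: complex) = 0"
      using ij by (intro assms) auto
    then show False by simp
  qed
  show "\<not> cfun.dependent (v ` I)"
  proof
    assume "cfun.dependent (v ` I)"
    then obtain T u w where T: "finite T" "T \<subseteq> v ` I" "(\<Sum>w\<in>T. cscale (u w) w) = 0"
      "w \<in> T" "u w \<noteq> 0"
      by (auto simp: cfun.dependent_explicit)
    \<comment> \<open>A finite set of indices representing \<open>T\<close>; injectivity turns the
      sum over vectors into a sum over indices.\<close>
    then obtain J where J: "J \<subseteq> I" "finite J" "T = v ` J"
      using finite_subset_image[OF T(1,2)] by blast
    have "(\<Sum>i\<in>J. cscale (u (v i)) (v i)) = 0"
      using T(3) unfolding J(3) by (simp add: sum.reindex inj_on_subset[OF inj J(1)])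
    then have "\<forall>i\<in>J. u (v i) = 0"
      by (rule assms[where c = "\<lambda>i. u (v i)", OF J(2,1)])
    then show False using T J by auto
  qed
qed

text \<open>Coefficients indexed by \<open>I\<close> become coefficients of vectors through the
  inverse of \<open>v\<close> on \<open>I\<close>.\<close>

lemma independent_familyD:
  assumes "inj_on v I" "\<not> cfun.dependent (v ` I)" "finite I"
    "(\<Sum>i\<in>I. cscale (c i) (v i)) = 0" "i \<in> I"
  shows "c i = 0"
proof -
  have "(\<Sum>w\<in>v ` I. cscale (c (the_inv_into I v w)) w) = 0"
    using assms by (simp add: sum.reindex the_inv_into_f_f)
  then have "c (the_inv_into I v (v i)) = 0"
    using assms by (intro cfun.independentD[OF assms(2)]) auto
  then show ?thesis using assms by (simp add: the_inv_into_f_f)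
qed

section \<open>The polar functions as a basis\<close>

text \<open>Homogeneity is applied with scaling factor \<open>norm x\<close> at
  \<open>x /\<^sub>R norm x\<close>. This remains valid at the origin, where division by zero
  returns the zero vector.\<close>

lemma polar_fun_eq:
  fixes Y :: "nat \<Rightarrow> nat \<Rightarrow> real ^ 'd::finite \<Rightarrow> complex"
  assumes "Y k l \<in> harmonic_polynomials k"
  shows "polar_fun Y k l j = norm_sq ^ j * Y k l"
proof
  fix x :: "real ^ 'd"
  have p: "(norm_sq ^ j) x = complex_of_real (norm x ^ (2 * j))"
    by (induction j) (auto simp: norm_sq_def power2_eq_square fun_apply)
  have "homogeneous_polynomial k (Y k l)" using assms by (simp add: harmonic_polynomials_eq)
  from homogeneous_apply_scale[OF this, of "norm x" "x /\<^sub>R norm x"]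
  have "Y k l x = of_real (norm x) ^ k * Y k l (x /\<^sub>R norm x)" by (cases "x = 0") auto
  then show "polar_fun Y k l j x = (norm_sq ^ j * Y k l) x"
    by (simp add: polar_fun_def p power_add fun_apply)
qed

theorem proposition1:
  fixes N :: nat
    and \<sigma> :: "(real ^ 'd::finite) measure"
    and Y :: "nat \<Rightarrow> nat \<Rightarrow> real ^ 'd \<Rightarrow> complex"
  assumes "CARD('d) \<ge> 2" and "N \<ge> 1"
    and "rotation_invariant_sphere_measure \<sigma>"
    and "\<And>k. is_basis_family {1..harmonic_dim TYPE('d) k} (Y k) (harmonic_polynomials k)"
    and "\<And>k l m. l \<in> {1..harmonic_dim TYPE('d) k} \<Longrightarrow> m \<in> {1..harmonic_dim TYPE('d) k} \<Longrightarrow>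
           sphere_inner \<sigma> (Y k l) (Y k m) = (if l = m then 1 else 0)"
  shows "is_basis_family
           {(k, l, j). l \<in> {1..harmonic_dim TYPE('d) k} \<and> j < N}
           (\<lambda>(k, l, j). polar_fun Y k l j)
           (polyharmonic_polynomials N)"
proof -
  let ?L = "\<lambda>k. {1..harmonic_dim TYPE('d) k}"
  let ?I = "{(k, l, j). l \<in> ?L k \<and> j < N}"
  let ?v = "\<lambda>(k, l, j). polar_fun Y k l j"
  have inj: "inj_on (Y k) (?L k)" and indep: "\<not> cfun.dependent (Y k ` ?L k)"
    and span: "cfun.span (Y k ` ?L k) = harmonic_polynomials k" for k
    using assms(4)[of k] by (auto simp: is_basis_family_def)
  have Y: "Y k l \<in> harmonic_polynomials k" if "l \<in> ?L k" for k l
    unfolding span[symmetric] using that by (intro cfun.span_base) auto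
  have v: "?v (k, l, j) = norm_sq ^ j * Y k l" if "l \<in> ?L k" for k l j
    using polar_fun_eq[of Y k l j] Y[OF that] by simp
  have "inj_on ?v ?I \<and> \<not> cfun.dependent (?v ` ?I)"
  proof (rule independent_familyI)
    fix J c assume J: "finite J" "J \<subseteq> ?I" "(\<Sum>i\<in>J. cscale (c i) (?v i)) = 0"
    define K where "K = Max (fst ` J)"
    \<comment> \<open>Extension by zero allows summation over the full box \<open>?B\<close> in
      place of the arbitrary set \<open>J\<close>.\<close>
    define c' where "c' i = (if i \<in> J then c i else 0)" for i
    \<comment> \<open>For fixed degree and exponent, the summands are collected into one harmonic
      polynomial, the coefficient of \<open>norm_sq ^ j\<close>.\<close>
    define h where "h k j = (\<Sum>l\<in>?L k. cscale (c' (k, l, j)) (Y k l))" for k j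
    have h: "h k j \<in> harmonic_polynomials k" for k j
      unfolding h_def
      by (intro cfun.subspace_sum[OF subspace_harmonic] harmonic_scale Y)
    have K: "k \<le> K" if "(k, l, j) \<in> J" for k l j
      unfolding K_def using J(1) that by (intro Max_ge) force+
    let ?B = "Sigma {..K} (\<lambda>k. ?L k \<times> {..<N})"
    have "J \<subseteq> ?B" using K J(2) by auto
    then have "(\<Sum>i\<in>?B. cscale (c' i) (?v i)) = (\<Sum>i\<in>J. cscale (c i) (?v i))"
      by (intro sum.mono_neutral_cong_right) (auto simp: c'_def cfun.scale_zero_left)
    then have "0 = (\<Sum>i\<in>?B. cscale (c' i) (?v i))" using J(3) by simp
    also have "\<dots> = (\<Sum>k\<le>K. \<Sum>l\<in>?L k. \<Sum>j<N. cscale (c' (k, l, j)) (?v (k, l, j)))"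
      by (simp add: sum.Sigma sum.cartesian_product split_def)
    also have "\<dots> = (\<Sum>k\<le>K. \<Sum>l\<in>?L k. \<Sum>j<N. norm_sq ^ j * cscale (c' (k, l, j)) (Y k l))"
    proof (intro sum.cong refl)
      fix k l j assume "l \<in> ?L k"
      show "cscale (c' (k, l, j)) (?v (k, l, j)) = norm_sq ^ j * cscale (c' (k, l, j)) (Y k l)"
        unfolding v[OF \<open>l \<in> ?L k\<close>] by (simp add: fun_eq_iff fun_apply)
    qed
    also have "\<dots> = (\<Sum>k\<le>K. \<Sum>j<N. norm_sq ^ j * h k j)"
      unfolding h_def sum_distrib_left by (intro sum.cong refl sum.swap)
    also have "\<dots> = (\<Sum>j<N. \<Sum>k\<le>K. norm_sq ^ j * h k j)"
      by (rule sum.swap)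
    finally have h0: "h k j = 0" if "k \<le> K" "j < N" for k j
      using almansi_terms_independent[where h = h and N = N and K = K, OF h _ that] by simp
    show "\<forall>i\<in>J. c i = 0"
    proof
      fix i assume i: "i \<in> J"
      obtain k l j where klj: "i = (k, l, j)" by (cases i)
      have l: "l \<in> ?L k" "j < N" "k \<le> K" using i J(2) K klj by auto
      \<comment> \<open>The equation \<open>h k j = 0\<close> is a linear relation among the
        independent \<open>Y k l\<close> with \<open>k\<close> and \<open>j\<close> fixed.\<close>
      have "c' (k, l, j) = 0"
        using independent_familyD[OF inj[of k] indep[of k], of "\<lambda>l. c' (k, l, j)" l] h0[OF l(3,2)] l(1)
        by (simp add: h_def)
      then show "c i = 0" using i klj by (simp add: c'_def)
    qed
  qed
  moreover have "cfun.span (?v ` ?I) = polyharmonic_polynomials N"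
    unfolding polyharmonic_polynomials_eq_span
  proof (rule antisym)
    have "?v ` ?I \<subseteq> almansi_terms N"
    proof (rule image_subsetI)
      fix i assume "i \<in> ?I"
      then obtain k l j where i: "i = (k, l, j)" and l: "l \<in> ?L k" and "j < N" by auto
      then show "?v i \<in> almansi_terms N"
        unfolding i v[OF l] almansi_terms_def using Y[OF l] by blast
    qed
    then show "cfun.span (?v ` ?I) \<subseteq> cfun.span (almansi_terms N)"
      by (rule cfun.span_mono)
    \<comment> \<open>Multiplication by \<open>norm_sq ^ j\<close> is linear, so an expansion of
      \<open>h\<close> in the basis \<open>Y k\<close> carries over to an expansion in polar
      functions.\<close>
    have "norm_sq ^ j * h \<in> cfun.span (?v ` ?I)" if "j < N" "h \<in> harmonic_polynomials k" for j h k
      using that(2) unfolding span[symmetric]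
    proof (induction rule: cfun.span_induct_alt)
      case base
      then show ?case by (simp add: cfun.span_zero)
    next
      case (step c y g)
      then obtain l where l: "l \<in> ?L k" and y: "y = Y k l" by auto
      have "norm_sq ^ j * y \<in> ?v ` ?I"
        unfolding y v[OF l, symmetric] using l \<open>j < N\<close> by (intro imageI) auto
      then have "cscale c (norm_sq ^ j * y) + norm_sq ^ j * g \<in> cfun.span (?v ` ?I)"
        by (rule cfun.span_add[OF cfun.span_scale[OF cfun.span_base] step(2)])
      moreover have "norm_sq ^ j * (cscale c y + g) = cscale c (norm_sq ^ j * y) + norm_sq ^ j * g"
        by (simp add: fun_eq_iff fun_apply algebra_simps)
      ultimately show ?case by simp
    qed
    then have "almansi_terms N \<subseteq> cfun.span (?v ` ?I)"
      by (auto simp: almansi_terms_def)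
    then show "cfun.span (almansi_terms N) \<subseteq> cfun.span (?v ` ?I)"
      by (rule cfun.span_minimal) simp
  qed
  ultimately show ?thesis by (simp add: is_basis_family_def)
qed

end
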